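(* For $n\ge1$ let $\mu_n=\frac Tn\sum_{i=0}^{n-1}\delta_{iT/n}$ and \[ f_n(t,x)=\mathbb{E}\Big[\exp\Big(\int_t^T\sum_{i=1}^3u_i(s)p_i(X_s)\mu_n(ds)+v(T)q(X_T)\Big)\,\Big|\,X_t=x\Big]. \] Then for each fixed $t\in[0,T]$, $f_n(t,\cdot)$ is entire on $\mathbb{R}$ (equal to a power series in $x$ with infinite radius of convergence).
   Context: Let $W$ be a Brownian motion; $a,b\in\mathbb{R}$, $c\ne0$, $T>0$; $dX_t=(a+bX_t)dt+c\,dW_t$. Negligible to double factorial: $\limsup_k(|p_k|(k-1)!!)^{1/k}=0$, $(-1)!!=0!!=1$. Standing assumptions: $u_1,u_2,u_3,v:[0,T]\to\mathbb{C}$ continuous with $\Re(u_1)\le0$, $\Re(u_2)=\Re(u_3)=\Re(v)=0$; $p_1=p^2$ for a real-coefficient power series $p$ negligible to double factorial; $p_2,p_3,q$ real-coefficient power series negligible to double factorial. *)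

theory Defs
  imports "HOL-Probability.Probability"
begin

definition brownian_motion :: "'a measure \<Rightarrow> (real \<Rightarrow> 'a \<Rightarrow> real) \<Rightarrow> bool" where
  "brownian_motion M W \<longleftrightarrow>
     prob_space M \<and>
     (\<forall>t\<ge>0. W t \<in> borel_measurable M) \<and>
     (AE \<omega> in M. W 0 \<omega> = 0) \<and>
     (\<forall>\<omega>\<in>space M. continuous_on {0..} (\<lambda>t. W t \<omega>)) \<and>
     (\<forall>s t. 0 \<le> s \<and> s < t \<longrightarrow>
        distributed M lborel (\<lambda>\<omega>. W t \<omega> - W s \<omega>) (\<lambda>y. ennreal (normal_density 0 (sqrt (t - s)) y))) \<and>
     (\<forall>(ts :: nat \<Rightarrow> real) (m :: nat). 0 \<le> ts 0 \<and> (\<forall>i<m. ts i < ts (Suc i)) \<longrightarrow>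
        prob_space.indep_vars M (\<lambda>_. borel) (\<lambda>i \<omega>. W (ts (Suc i)) \<omega> - W (ts i) \<omega>) {..<m})"

text \<open>Double factorial; (k-1)!! is written dfact (k - 1), which gives (-1)!! = 0!! = 1.\<close>
fun dfact :: "nat \<Rightarrow> nat" where
  "dfact 0 = 1"
| "dfact (Suc 0) = 1"
| "dfact (Suc (Suc n)) = Suc (Suc n) * dfact n"

definition negligible_dfact :: "(nat \<Rightarrow> real) \<Rightarrow> bool" where
  "negligible_dfact p \<longleftrightarrow>
     limsup (\<lambda>k. ereal (root k (\<bar>p k\<bar> * real (dfact (k - 1))))) = 0"

definition pser :: "(nat \<Rightarrow> real) \<Rightarrow> real \<Rightarrow> real" where
  "pser p x = (\<Sum>k. p k * x ^ k)"

definition pser_sq :: "(nat \<Rightarrow> real) \<Rightarrow> nat \<Rightarrow> real" where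
  "pser_sq p k = (\<Sum>j\<le>k. p j * p (k - j))"

text \<open>Integral over [t,T] w.r.t. mu_n = (T/n) sum_{i<n} delta_{iT/n}.\<close>
definition mu_int :: "real \<Rightarrow> nat \<Rightarrow> real \<Rightarrow> (real \<Rightarrow> complex) \<Rightarrow> complex" where
  "mu_int T n t g =
     of_real (T / real n) * (\<Sum>i\<in>{i. i < n \<and> t \<le> real i * T / real n}. g (real i * T / real n))"

text \<open>f_n(t,x) = E[exp(int_t^T sum_i u_i(s) p_i(X_s) mu_n(ds) + v(T) q(X_T))], where X is the
  solution started at x at time t (given as the path family X x s omega).\<close>
definition fn :: "'a measure \<Rightarrow> (real \<Rightarrow> real \<Rightarrow> 'a \<Rightarrow> real) \<Rightarrow> real \<Rightarrow>
    (real \<Rightarrow> complex) \<Rightarrow> (real \<Rightarrow> complex) \<Rightarrow> (real \<Rightarrow> complex) \<Rightarrow> (real \<Rightarrow> complex) \<Rightarrow>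
    (nat \<Rightarrow> real) \<Rightarrow> (nat \<Rightarrow> real) \<Rightarrow> (nat \<Rightarrow> real) \<Rightarrow> (nat \<Rightarrow> real) \<Rightarrow>
    nat \<Rightarrow> real \<Rightarrow> real \<Rightarrow> complex" where
  "fn M X T u1 u2 u3 v p1 p2 p3 q n t x =
     integral\<^sup>L M (\<lambda>\<omega>. exp (
        mu_int T n t (\<lambda>s. u1 s * of_real (pser p1 (X x s \<omega>))
                        + u2 s * of_real (pser p2 (X x s \<omega>))
                        + u3 s * of_real (pser p3 (X x s \<omega>)))
        + v T * of_real (pser q (X x T \<omega>))))"

end

theory Submission
  imports Defs "HOL-Complex_Analysis.Complex_Analysis"
begin

text \<open>
  Let \<open>s\<close> be the first grid point after \<open>t\<close>. Solving the linear equation pathwise writes \<open>X\<close> at the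
  grid points \<open>s\<^sub>j \<ge> s\<close> as an affine function of \<open>\<kappa> x + S + R\<^sub>j\<close>, where \<open>S\<close> and \<open>R\<^sub>j\<close> are the
  integrals of \<open>exp (- b r)\<close> against \<open>dW\<close> over \<open>[t, s]\<close> and \<open>[s, s\<^sub>j]\<close>. The integrand is then an
  entire function of \<open>x\<close> (the grid point \<open>t\<close>, if present) times a product of continuous functions of
  the \<open>\<kappa> x + S + R\<^sub>j\<close>, bounded by 1 because all exponents have nonpositive real part.
  Approximating \<open>S\<close> and the \<open>R\<^sub>j\<close> by Riemann sums, which are independent with the first one Gaussian,
  shows that the expectation has the form \<open>\<integral> B (\<kappa> x + \<sigma> y) d\<gamma>(y)\<close> with \<open>B\<close> bounded, \<open>\<sigma> > 0\<close> and
  \<open>\<gamma>\<close> standard Gaussian. Moving \<open>x\<close> into the Gaussian density makes this entire in \<open>x\<close>.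
\<close>

section \<open>Restrictions of entire functions to the real line\<close>

text \<open>A holomorphic extension is required, rather than a power series, so that sums, products,
  exponentials and dilations need no manipulation of coefficients.
  \<open>extends_entire_sums\<close> and \<open>extends_entire_imp_sums\<close> translate from and
  to power series.\<close>

definition extends_entire :: "(real \<Rightarrow> complex) \<Rightarrow> bool" where
  "extends_entire f \<longleftrightarrow> (\<exists>F. F holomorphic_on UNIV \<and> (\<forall>x. F (of_real x) = f x))"

lemma extends_entire_const: "extends_entire (\<lambda>x. z)"
  unfolding extends_entire_def by (rule exI[of _ "\<lambda>_. z"]) auto

lemma extends_entire_of_real: "extends_entire of_real"
  unfolding extends_entire_def by (rule exI[of _ "\<lambda>z. z"]) auto

lemma extends_entire_add:
  assumes "extends_entire f" "extends_entire g"
  shows "extends_entire (\<lambda>x. f x + g x)"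
proof -
  obtain F G where "F holomorphic_on UNIV" "\<And>x. F (of_real x) = f x"
    "G holomorphic_on UNIV" "\<And>x. G (of_real x) = g x"
    using assms unfolding extends_entire_def by blast
  then show ?thesis unfolding extends_entire_def
    by (intro exI[of _ "\<lambda>z. F z + G z"]) (auto intro!: holomorphic_intros)
qed

lemma extends_entire_mult:
  assumes "extends_entire f" "extends_entire g"
  shows "extends_entire (\<lambda>x. f x * g x)"
proof -
  obtain F G where "F holomorphic_on UNIV" "\<And>x. F (of_real x) = f x"
    "G holomorphic_on UNIV" "\<And>x. G (of_real x) = g x"
    using assms unfolding extends_entire_def by blast
  then show ?thesis unfolding extends_entire_def
    by (intro exI[of _ "\<lambda>z. F z * G z"]) (auto intro!: holomorphic_intros)
qed

lemma extends_entire_exp: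
  assumes "extends_entire f"
  shows "extends_entire (\<lambda>x. exp (f x))"
proof -
  obtain F where "F holomorphic_on UNIV" "\<And>x. F (of_real x) = f x"
    using assms unfolding extends_entire_def by blast
  then show ?thesis unfolding extends_entire_def
    by (intro exI[of _ "\<lambda>z. exp (F z)"]) (auto intro!: holomorphic_intros)
qed

lemma extends_entire_scale:
  assumes "extends_entire f"
  shows "extends_entire (\<lambda>x. f (k * x))"
proof -
  obtain F where F: "F holomorphic_on UNIV" "\<And>x. F (of_real x) = f x"
    using assms unfolding extends_entire_def by blast
  have "(F \<circ> (\<lambda>z. of_real k * z)) holomorphic_on UNIV"
    by (rule holomorphic_on_compose_gen[OF _ F(1)]) (auto intro!: holomorphic_intros)
  moreover have "\<And>x. (F \<circ> (\<lambda>z. of_real k * z)) (of_real x) = f (k * x)"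
    using F(2)[of "k * x" for x] by simp
  ultimately show ?thesis unfolding extends_entire_def by blast
qed

text \<open>Convergence at the real point \<open>norm z + 1\<close> forces convergence at
  \<open>z\<close>, so convergence on the real line alone gives an infinite radius of convergence in
  the complex plane.\<close>

lemma extends_entire_sums:
  fixes d :: "nat \<Rightarrow> complex"
  assumes "\<And>x::real. (\<lambda>k. d k * of_real x ^ k) sums f x"
  shows "extends_entire f"
proof -
  define F where "F z = (\<Sum>k. d k * z ^ k)" for z
  have "(\<lambda>k. d k * z ^ k) sums F z" for z
  proof -
    have "summable (\<lambda>k. d k * (of_real (norm z + 1)) ^ k)"
      using assms sums_summable by blast
    moreover have "norm z < norm (of_real (norm z + 1) :: complex)"
      by (simp only: norm_of_real)
    ultimately show ?thesis
      unfolding F_def using powser_inside by (blast intro: summable_sums)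
  qed
  then have "F holomorphic_on ball 0 r" for r
    using power_series_holomorphic[of 0 r d F] by simp
  then have "F holomorphic_on (\<Union>r. ball 0 r)"
    by (intro holomorphic_on_UN_open) auto
  moreover have "(\<Union>r. ball (0::complex) r) = UNIV"
  proof -
    have "z \<in> ball 0 (norm z + 1)" for z :: complex by simp
    then show ?thesis by blast
  qed
  ultimately have "F holomorphic_on UNIV" by simp
  moreover have "F (of_real x) = f x" for x
    using assms[of x] unfolding F_def by (simp add: sums_iff)
  ultimately show ?thesis
    unfolding extends_entire_def by blast
qed

text \<open>The Taylor coefficients at 0 do not depend on the disc of expansion, so one sequence
  serves every \<open>x\<close>, although the disc of radius |x| + 1 varies with
  \<open>x\<close>.\<close>

lemma extends_entire_imp_sums:
  assumes "extends_entire f"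
  shows "\<exists>d :: nat \<Rightarrow> complex. \<forall>x::real. (\<lambda>k. d k * of_real x ^ k) sums f x"
proof -
  obtain F where F: "F holomorphic_on UNIV" "\<And>x. F (of_real x) = f x"
    using assms unfolding extends_entire_def by blast
  have "(\<lambda>k. (deriv ^^ k) F 0 / fact k * (of_real x - 0) ^ k) sums F (of_real x)" for x
    by (rule holomorphic_power_series[of F 0 "\<bar>x\<bar> + 1"])
      (auto intro: holomorphic_on_subset[OF F(1)])
  then show ?thesis
    by (intro exI[of _ "\<lambda>k. (deriv ^^ k) F 0 / fact k"]) (simp only: F(2) diff_zero simp_thms)
qed

section \<open>Power series negligible to double factorial\<close>

lemma dfact_ge_1: "1 \<le> dfact k"
  by (induction k rule: dfact.induct) auto

text \<open>Root test: because double factorials are at least 1, negligibility gives |p k| \<le>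
  \<open>e ^ k\<close> eventually, for any \<open>e > 0\<close>. The chosen \<open>e\<close> leaves
  a geometric majorant of ratio 1/2.\<close>

lemma negligible_dfact_summable:
  assumes "negligible_dfact p"
  shows "summable (\<lambda>k. norm (p k * x ^ k))"
proof -
  define e where "e = 1 / (2 * (\<bar>x\<bar> + 1))"
  have e: "e > 0" unfolding e_def by auto
  have ex: "e * \<bar>x\<bar> \<le> 1 / 2" unfolding e_def by (auto simp: field_simps)
  have "limsup (\<lambda>k. ereal (root k (\<bar>p k\<bar> * real (dfact (k - 1))))) < ereal e"
    using assms e unfolding negligible_dfact_def by simp
  then have "\<forall>\<^sub>F k in sequentially. ereal (root k (\<bar>p k\<bar> * real (dfact (k - 1)))) < ereal e"
    by (rule Limsup_lessD)
  then have "\<forall>\<^sub>F k in sequentially. norm (norm (p k * x ^ k)) \<le> (1/2) ^ k"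
    \<comment> \<open>\<open>root 0\<close> is constantly 0, so cancelling the root against the
      power below requires \<open>k > 0\<close>.\<close>
    using eventually_gt_at_top[of 0]
  proof eventually_elim
    case (elim k)
    have "\<bar>p k\<bar> * 1 \<le> \<bar>p k\<bar> * real (dfact (k - 1))"
      using dfact_ge_1[of "k - 1"] by (intro mult_left_mono) auto
    also have "\<dots> = root k (\<bar>p k\<bar> * real (dfact (k - 1))) ^ k"
      using elim by simp
    also have "\<dots> \<le> e ^ k"
      using elim by (intro power_mono) auto
    finally have "norm (norm (p k * x ^ k)) \<le> (e * \<bar>x\<bar>) ^ k"
      by (auto simp: abs_mult power_abs power_mult_distrib intro!: mult_right_mono)
    also have "\<dots> \<le> (1/2) ^ k"
      using ex e by (intro power_mono) auto
    finally show ?case .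
  qed
  then show ?thesis
    by (rule summable_comparison_test_ev) (simp add: summable_geometric)
qed

lemma negligible_dfact_sums:
  assumes "negligible_dfact p"
  shows "(\<lambda>k. p k * x ^ k) sums pser p x"
  unfolding pser_def
  by (rule summable_sums[OF summable_norm_cancel[OF negligible_dfact_summable[OF assms]]])

lemma extends_entire_pser:
  assumes "negligible_dfact p"
  shows "extends_entire (\<lambda>x. of_real (pser p x))"
proof (rule extends_entire_sums)
  fix x :: real
  have "(\<lambda>k. complex_of_real (p k * x ^ k)) sums of_real (pser p x)"
    unfolding sums_of_real_iff by (rule negligible_dfact_sums[OF assms])
  then show "(\<lambda>k. complex_of_real (p k) * of_real x ^ k) sums of_real (pser p x)" by simp
qed

text \<open>Absolute convergence permits the Cauchy product. The square is what makes the exponent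
  belonging to \<open>u1\<close> have nonpositive real part.\<close>

lemma pser_sq:
  assumes "negligible_dfact p"
  shows "pser (pser_sq p) x = (pser p x)\<^sup>2"
proof -
  have "(\<lambda>k. \<Sum>i\<le>k. (p i * x ^ i) * (p (k - i) * x ^ (k - i))) sums (pser p x * pser p x)"
    unfolding pser_def
    by (rule Cauchy_product_sums[OF negligible_dfact_summable negligible_dfact_summable]) fact+
  moreover have "(\<Sum>i\<le>k. (p i * x ^ i) * (p (k - i) * x ^ (k - i))) = pser_sq p k * x ^ k" for k
    unfolding pser_sq_def sum_distrib_right
    by (intro sum.cong refl) (simp flip: power_add)
  ultimately show ?thesis
    unfolding pser_def[of "pser_sq p"] by (simp add: sums_iff power2_eq_square)
qed

lemma extends_entire_imp_continuous:
  assumes "extends_entire f"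
  shows "continuous_on UNIV f"
proof -
  obtain F where F: "F holomorphic_on UNIV" "\<And>x. F (of_real x) = f x"
    using assms unfolding extends_entire_def by blast
  have "continuous_on UNIV (\<lambda>x::real. F (of_real x))"
    by (rule continuous_on_compose2[OF holomorphic_on_imp_continuous_on[OF F(1)]])
      (auto intro!: continuous_intros)
  then show ?thesis using F(2) by simp
qed

section \<open>Pathwise integration\<close>

text \<open>Brownian paths have no bounded variation, so the limit is expressed by integration by
  parts, which asks only continuity of \<open>w\<close>. Abel summation moves the differences onto
  \<open>f\<close>; on each cell the difference of \<open>f\<close> is the integral of
  \<open>f'\<close>, and replacing \<open>w\<close> by its value at the right endpoint costs little
  by uniform continuity.\<close>

lemma riemann_stieltjes_sum_tendsto:
  fixes f f' w :: "real \<Rightarrow> real"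
  assumes us: "u \<le> s"
    and df: "\<And>r. (f has_real_derivative f' r) (at r)"
    and cf': "continuous_on UNIV f'"
    and w: "continuous_on {u..s} w"
  defines "r N k \<equiv> u + real k * (s - u) / real N"
  shows "(\<lambda>N. \<Sum>k<N. f (r N k) * (w (r N (Suc k)) - w (r N k)))
           \<longlonglongrightarrow> f s * w s - f u * w u - integral {u..s} (\<lambda>x. f' x * w x)"
proof -
  have cfw: "continuous_on {u..s} (\<lambda>x. f' x * w x)"
    by (intro continuous_intros w continuous_on_subset[OF cf']) auto
  obtain K where K: "K > 0" "\<And>x. x \<in> {u..s} \<Longrightarrow> \<bar>f' x\<bar> \<le> K"
  proof -
    have "bounded (f' ` {u..s})"
      by (intro compact_imp_bounded compact_continuous_image continuous_on_subset[OF cf']) auto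
    then show ?thesis using that unfolding bounded_pos by auto
  qed
  have uc: "uniformly_continuous_on {u..s} w"
    by (rule compact_uniformly_continuous[OF w]) auto
  show ?thesis
  proof (rule LIMSEQ_I)
    fix e :: real assume e: "e > 0"
    \<comment> \<open>Chosen so that the total error \<open>K * e' * (s - u)\<close> stays below
      \<open>e / 2\<close>; the summand 1 keeps the divisor positive when
      \<open>u = s\<close>.\<close>
    define e' where "e' = e / 2 / K / (s - u + 1)"
    have e': "e' > 0" unfolding e'_def using e K us by auto
    obtain d where d: "d > 0" "\<And>x y. x \<in> {u..s} \<Longrightarrow> y \<in> {u..s} \<Longrightarrow> dist y x < d \<Longrightarrow> dist (w y) (w x) < e'"
      using uc e' unfolding uniformly_continuous_on_def by metis
    obtain N0 :: nat where N0: "real N0 > (s - u) / d" using reals_Archimedean2 by blast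
    have "norm ((\<Sum>k<N. f (r N k) * (w (r N (Suc k)) - w (r N k)))
        - (f s * w s - f u * w u - integral {u..s} (\<lambda>x. f' x * w x))) < e" if N: "N \<ge> Suc N0" for N
    proof -
      have Npos: "N > 0" using N by simp
      have mesh: "(s - u) / real N < d"
      proof -
        have "(s - u) / d < real N" using N N0 by linarith
        then show ?thesis using d Npos by (simp add: field_simps)
      qed
      have r0: "r N 0 = u" and rN: "r N N = s" unfolding r_def using Npos by auto
      have rstep: "r N (Suc k) = r N k + (s - u) / real N" for k
        unfolding r_def by (simp add: distrib_right add_divide_distrib)
      have rmono: "r N k \<le> r N (Suc k)" for k using us by (simp add: rstep)
      have rin: "r N k \<in> {u..s}" if "k \<le> N" for k
      proof -
        have "real k * (s - u) \<le> real N * (s - u)" using that us by (intro mult_right_mono) auto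
        then have "real k * (s - u) / real N \<le> s - u" using Npos by (simp add: divide_le_eq mult.commute)
        then show ?thesis unfolding r_def using us by auto
      qed
      have split: "integral {u..r N m} (\<lambda>x. f' x * w x)
          = (\<Sum>k<m. integral {r N k..r N (Suc k)} (\<lambda>x. f' x * w x))" if "m \<le> N" for m
        using that
      proof (induction m)
        case (Suc m)
        have "integral {u..r N m} (\<lambda>x. f' x * w x) + integral {r N m..r N (Suc m)} (\<lambda>x. f' x * w x)
          = integral {u..r N (Suc m)} (\<lambda>x. f' x * w x)"
          using rin[of m] rin[of "Suc m"] Suc.prems rmono[of m]
          by (intro Henstock_Kurzweil_Integration.integral_combine integrable_continuous_real
              continuous_on_subset[OF cfw]) auto
        with Suc show ?case by simp
      qed (simp add: r0)
      have parts: "(\<Sum>k<m. f (r N k) * (w (r N (Suc k)) - w (r N k)))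
          = f (r N m) * w (r N m) - f u * w u
            - (\<Sum>k<m. (f (r N (Suc k)) - f (r N k)) * w (r N (Suc k)))" for m
        by (induction m) (auto simp: r0 algebra_simps)
      have piece: "\<bar>integral {r N k..r N (Suc k)} (\<lambda>x. f' x * w x)
          - (f (r N (Suc k)) - f (r N k)) * w (r N (Suc k))\<bar> \<le> K * e' * ((s - u) / N)" if k: "k < N" for k
      proof -
        let ?A = "r N k" and ?B = "r N (Suc k)"
        have AB: "{?A..?B} \<subseteq> {u..s}" using rin[of k] rin[of "Suc k"] k by auto
        have "(f' has_integral f ?B - f ?A) {?A..?B}"
          by (intro fundamental_theorem_of_calculus rmono)
            (auto simp flip: has_real_derivative_iff_has_vector_derivative
              intro: has_field_derivative_at_within df)
        then have hB: "((\<lambda>x. f' x * w ?B) has_integral (f ?B - f ?A) * w ?B) {?A..?B}"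
          by (rule has_integral_mult_left)
        have hw: "((\<lambda>x. f' x * w x) has_integral integral {?A..?B} (\<lambda>x. f' x * w x)) {?A..?B}"
          using AB by (intro integrable_integral integrable_continuous_real continuous_on_subset[OF cfw])
        have hi: "((\<lambda>x. f' x * w x - f' x * w ?B) has_integral
            integral {?A..?B} (\<lambda>x. f' x * w x) - (f ?B - f ?A) * w ?B) (cbox ?A ?B)"
          using has_integral_diff[OF hw hB] by simp
        have "norm (integral {?A..?B} (\<lambda>x. f' x * w x) - (f ?B - f ?A) * w ?B)
            \<le> K * e' * measure lborel (cbox ?A ?B)"
        proof (rule has_integral_bound[OF _ hi])
          show "0 \<le> K * e'" using K e' by simp
          fix x assume x: "x \<in> cbox ?A ?B"
          then have xin: "x \<in> {u..s}" using AB by auto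
          have "?B \<in> {u..s}" using rin[of "Suc k"] k by auto
          moreover have "dist x ?B < d"
            using x mesh rstep[of k] by (auto simp: dist_real_def)
          ultimately have "dist (w x) (w ?B) < e'" using d xin by blast
          then have "\<bar>f' x\<bar> * \<bar>w x - w ?B\<bar> \<le> K * e'"
            using K(2)[OF xin] K(1) by (intro mult_mono) (auto simp: dist_real_def)
          then show "norm (f' x * w x - f' x * w ?B) \<le> K * e'"
            by (simp flip: right_diff_distrib abs_mult)
        qed
        then show ?thesis using rmono[of k] rstep[of k] by simp
      qed
      have "\<bar>(\<Sum>k<N. f (r N k) * (w (r N (Suc k)) - w (r N k)))
          - (f s * w s - f u * w u - integral {u..s} (\<lambda>x. f' x * w x))\<bar>
        = \<bar>\<Sum>k<N. integral {r N k..r N (Suc k)} (\<lambda>x. f' x * w x)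
            - (f (r N (Suc k)) - f (r N k)) * w (r N (Suc k))\<bar>"
        using parts[of N] split[of N] by (simp add: rN sum_subtractf)
      also have "\<dots> \<le> (\<Sum>k<N. K * e' * ((s - u) / N))"
        by (rule order_trans[OF sum_abs]) (intro sum_mono piece, simp)
      also have "\<dots> = K * e' * (s - u)" using Npos by simp
      also have "\<dots> \<le> K * e' * (s - u + 1)"
        using K e' by (intro mult_left_mono) auto
      also have "\<dots> = e / 2"
      proof -
        have "A * (E / A / L) * L = E" if "A \<noteq> 0" "L \<noteq> 0" for A L E :: real
          using that by simp
        from this[of K "s - u + 1" "e / 2"] show ?thesis
          unfolding e'_def using K us by simp
      qed
      also have "\<dots> < e" using e by simp
      finally show ?thesis by simp
    qed
    then show "\<exists>no. \<forall>N\<ge>no. norm ((\<Sum>k<N. f (r N k) * (w (r N (Suc k)) - w (r N k)))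
        - (f s * w s - f u * w u - integral {u..s} (\<lambda>x. f' x * w x))) < e" by blast
  qed
qed

text \<open>Variation of constants along a single path. Subtracting the noise
  \<open>c * (W s - W t)\<close> from \<open>X\<close> leaves a function \<open>D\<close> that is
  differentiable although \<open>W\<close> is not, so the integrating factor
  \<open>exp (- b * r)\<close> can be used with ordinary calculus.\<close>

lemma linear_integral_equation_solution:
  fixes X W :: "real \<Rightarrow> real"
  assumes ts: "t \<le> s" "s \<le> T"
    and cX: "continuous_on {t..T} X"
    and cW: "continuous_on {t..T} W"
    and X: "\<And>s. s \<in> {t..T} \<Longrightarrow> X s = x + integral {t..s} (\<lambda>r. a + b * X r) + c * (W s - W t)"
  shows "X s = exp (b * s) * (exp (- b * t) * x + integral {t..s} (\<lambda>r. a * exp (- b * r))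
     + c * (exp (- b * s) * W s - exp (- b * t) * W t
            - integral {t..s} (\<lambda>r. - b * exp (- b * r) * W r)))"
proof -
  define D where "D s = x + integral {t..s} (\<lambda>r. a + b * X r)" for s
  have D: "X r = D r + c * (W r - W t)" if "r \<in> {t..T}" for r
    using X[OF that] by (simp add: D_def)
  have dD: "(D has_real_derivative a + b * X r) (at r within {t..s})" if "r \<in> {t..s}" for r
  proof -
    have "((\<lambda>x. integral {t..x} (\<lambda>r. a + b * X r)) has_real_derivative a + b * X r) (at r within {t..s})"
      by (rule integral_has_real_derivative)
        (use that ts in \<open>auto intro!: continuous_intros continuous_on_subset[OF cX]\<close>)
    then show ?thesis unfolding D_def by (auto intro!: derivative_eq_intros)
  qed
  \<comment> \<open>The derivative is \<open>exp (- b * r) * (a + b * X r - b * D r)\<close>, and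
    \<open>X r - D r\<close> is the noise, so the unknown \<open>X\<close> disappears from the
    right-hand side.\<close>
  have "((\<lambda>r. exp (- b * r) * D r) has_real_derivative
      a * exp (- b * r) + (b * c) * (exp (- b * r) * (W r - W t))) (at r within {t..s})"
    if r: "r \<in> {t..s}" for r
  proof -
    have "X r = D r + c * (W r - W t)" using D r ts by auto
    then show ?thesis
      using r by (auto intro!: derivative_eq_intros dD simp: \<open>X r = _\<close> algebra_simps)
  qed
  then have "((\<lambda>r. a * exp (- b * r) + (b * c) * (exp (- b * r) * (W r - W t))) has_integral
      exp (- b * s) * D s - exp (- b * t) * D t) {t..s}"
    by (intro fundamental_theorem_of_calculus ts)
      (simp flip: has_real_derivative_iff_has_vector_derivative)
  then have 1: "integral {t..s} (\<lambda>r. a * exp (- b * r) + (b * c) * (exp (- b * r) * (W r - W t)))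
      = exp (- b * s) * D s - exp (- b * t) * x"
    by (simp add: integral_unique D_def)
  have cW': "continuous_on {t..s} W" using cW ts by (auto intro: continuous_on_subset)
  \<comment> \<open>The part with the constant \<open>W t\<close> is integrated explicitly. Its
    value at \<open>s\<close> cancels against the noise restored at the end, and its value at
    \<open>t\<close> gives the boundary term \<open>exp (- b * t) * W t\<close>.\<close>
  have "((\<lambda>r. - b * exp (- b * r)) has_integral exp (- b * s) - exp (- b * t)) {t..s}"
    by (intro fundamental_theorem_of_calculus ts)
      (auto simp flip: has_real_derivative_iff_has_vector_derivative intro!: derivative_eq_intros)
  then have "((\<lambda>r. c * W t * (- b * exp (- b * r))) has_integral
      c * W t * (exp (- b * s) - exp (- b * t))) {t..s}"
    by (rule has_integral_mult_right)
  moreover have "((\<lambda>r. a * exp (- b * r)) has_integral integral {t..s} (\<lambda>r. a * exp (- b * r))) {t..s}"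
    by (intro integrable_integral integrable_continuous_real continuous_intros)
  moreover have "((\<lambda>r. c * (- b * exp (- b * r) * W r)) has_integral
     c * integral {t..s} (\<lambda>r. - b * exp (- b * r) * W r)) {t..s}"
    by (intro has_integral_mult_right integrable_integral integrable_continuous_real continuous_intros cW')
  ultimately have "((\<lambda>r. a * exp (- b * r) + c * W t * (- b * exp (- b * r)) - c * (- b * exp (- b * r) * W r))
     has_integral (integral {t..s} (\<lambda>r. a * exp (- b * r)) + c * W t * (exp (- b * s) - exp (- b * t))
       - c * integral {t..s} (\<lambda>r. - b * exp (- b * r) * W r))) {t..s}"
    by (intro has_integral_diff has_integral_add)
  then have 2: "integral {t..s} (\<lambda>r. a * exp (- b * r) + (b * c) * (exp (- b * r) * (W r - W t)))
    = integral {t..s} (\<lambda>r. a * exp (- b * r)) + c * W t * (exp (- b * s) - exp (- b * t))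
       - c * integral {t..s} (\<lambda>r. - b * exp (- b * r) * W r)"
    by (intro integral_unique) (simp add: algebra_simps)
  have "exp (- b * s) * X s = exp (- b * s) * D s + exp (- b * s) * (c * (W s - W t))"
    using D[of s] ts by (simp add: distrib_left)
  also have "\<dots> = exp (- b * t) * x + integral {t..s} (\<lambda>r. a * exp (- b * r))
     + c * (exp (- b * s) * W s - exp (- b * t) * W t
            - integral {t..s} (\<lambda>r. - b * exp (- b * r) * W r))" (is "_ = ?R")
    using 1 2 by (simp add: algebra_simps)
  finally have "exp (b * s) * (exp (- b * s) * X s) = exp (b * s) * ?R" by simp
  moreover have "exp (b * s) * (exp (- b * s) * X s) = X s"
    by (simp flip: mult.assoc exp_add)
  ultimately show ?thesis by simp
qed

section \<open>Gaussian smoothing\<close>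

lemma std_normal_density_shift:
  "std_normal_density (y - u) = std_normal_density y * exp (u * y) * exp (- u\<^sup>2 / 2)"
proof -
  have "- (y - u)\<^sup>2 / 2 = - y\<^sup>2 / 2 + u * y + - u\<^sup>2 / 2"
    by (simp add: power2_eq_square field_simps)
  then have "exp (- (y - u)\<^sup>2 / 2) = exp (- y\<^sup>2 / 2) * exp (u * y) * exp (- u\<^sup>2 / 2)"
    by (simp only: exp_add)
  then show ?thesis unfolding std_normal_density_def by simp
qed

text \<open>Tilting the standard normal density by \<open>exp (u * y)\<close> gives a constant
  multiple of the normal density with mean \<open>u\<close>.\<close>

lemma integrable_std_normal_exp:
  "integrable lborel (\<lambda>y. std_normal_density y * exp (u * y))"
proof -
  have "std_normal_density y * exp (u * y) = exp (u\<^sup>2 / 2) * normal_density u 1 y" for y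
  proof -
    have "normal_density u 1 y = std_normal_density (y - u)"
      unfolding normal_density_def by simp
    then show ?thesis
      by (simp add: std_normal_density_shift exp_minus)
  qed
  then show ?thesis by simp
qed

text \<open>Expanding \<open>exp (u * y)\<close> and integrating termwise gives the power series
  whose coefficients are the Gaussian moments of \<open>B\<close> divided by factorials. The partial
  sums are dominated through exp |u y| \<le> exp (u y) + exp (- u y), which is integrable against
  the Gaussian.\<close>

lemma gaussian_laplace_extends_entire:
  fixes B :: "real \<Rightarrow> complex"
  assumes [measurable]: "B \<in> borel_measurable borel" and B: "\<And>y. norm (B y) \<le> 1"
  shows "extends_entire (\<lambda>u. \<integral>y. (std_normal_density y * exp (u * y)) *\<^sub>R B y \<partial>lborel)"
proof (rule extends_entire_sums)
  fix u :: real
  let ?d = "\<lambda>k. (\<integral>y. (std_normal_density y * y ^ k) *\<^sub>R B y \<partial>lborel) / fact k"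
  let ?s = "\<lambda>N y. \<Sum>k<N. ((u * y) ^ k / fact k) *\<^sub>R (std_normal_density y *\<^sub>R B y)"
  have int: "integrable lborel (\<lambda>y. (std_normal_density y * y ^ k) *\<^sub>R B y)" for k
  proof (rule Bochner_Integration.integrable_bound[OF integrable_std_normal_moment_abs[of k]])
    show "AE y in lborel. norm ((std_normal_density y * y ^ k) *\<^sub>R B y)
        \<le> norm (std_normal_density y * \<bar>y\<bar> ^ k)"
      using B by (intro AE_I2) (auto simp: abs_mult power_abs intro!: mult_left_le)
  qed simp
  have eq: "((u * y) ^ k / fact k) *\<^sub>R (std_normal_density y *\<^sub>R B y)
      = (u ^ k / fact k) *\<^sub>R ((std_normal_density y * y ^ k) *\<^sub>R B y)" for k y
    by (simp add: power_mult_distrib mult_ac)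
  have "(\<lambda>N. \<integral>y. ?s N y \<partial>lborel) \<longlonglongrightarrow>
      (\<integral>y. exp (u * y) *\<^sub>R (std_normal_density y *\<^sub>R B y) \<partial>lborel)"
  proof (rule integral_dominated_convergence)
    show "integrable lborel (\<lambda>y. std_normal_density y * exp (u * y) + std_normal_density y * exp (- u * y))"
      by (intro Bochner_Integration.integrable_add integrable_std_normal_exp)
    show "AE y in lborel. (\<lambda>N. ?s N y) \<longlonglongrightarrow> exp (u * y) *\<^sub>R (std_normal_density y *\<^sub>R B y)"
    proof (intro AE_I2)
      fix y :: real
      have "(\<lambda>k. (u * y) ^ k / fact k) sums exp (u * y)"
        using exp_converges[of "u * y"] by (simp add: divide_inverse mult.commute)
      then show "(\<lambda>N. ?s N y) \<longlonglongrightarrow> exp (u * y) *\<^sub>R (std_normal_density y *\<^sub>R B y)"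
        unfolding sums_def scaleR_sum_left[symmetric] by (intro tendsto_intros)
    qed
    show "AE y in lborel. norm (?s N y)
        \<le> std_normal_density y * exp (u * y) + std_normal_density y * exp (- u * y)" for N
    proof (intro AE_I2)
      fix y :: real
      have sums: "(\<lambda>k. \<bar>u * y\<bar> ^ k / fact k) sums exp \<bar>u * y\<bar>"
        using exp_converges[of "\<bar>u * y\<bar>"] by (simp add: divide_inverse mult.commute)
      have "\<bar>\<Sum>k<N. (u * y) ^ k / fact k\<bar> \<le> (\<Sum>k<N. \<bar>u * y\<bar> ^ k / fact k)"
        by (rule order_trans[OF sum_abs]) (simp add: power_abs)
      also have "\<dots> \<le> exp \<bar>u * y\<bar>"
        using sum_le_suminf[OF sums_summable[OF sums], of "{..<N}"] sums_unique[OF sums] by simp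
      also have "\<dots> \<le> exp (u * y) + exp (- u * y)"
        by (cases "u * y \<ge> 0") auto
      finally have 1: "\<bar>\<Sum>k<N. (u * y) ^ k / fact k\<bar> \<le> exp (u * y) + exp (- u * y)" .
      have "norm (?s N y) = \<bar>\<Sum>k<N. (u * y) ^ k / fact k\<bar> * (std_normal_density y * norm (B y))"
        unfolding scaleR_sum_left[symmetric] by (simp add: abs_mult)
      also have "\<dots> \<le> (exp (u * y) + exp (- u * y)) * (std_normal_density y * 1)"
        by (intro mult_mono 1 B) auto
      finally show "norm (?s N y)
        \<le> std_normal_density y * exp (u * y) + std_normal_density y * exp (- u * y)"
        by (simp add: algebra_simps)
    qed
  qed simp_all
  also have "(\<lambda>N. \<integral>y. ?s N y \<partial>lborel) = (\<lambda>N. \<Sum>k<N. ?d k * of_real u ^ k)"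
  proof
    fix N
    have "(\<integral>y. ?s N y \<partial>lborel)
        = (\<Sum>k<N. \<integral>y. (u ^ k / fact k) *\<^sub>R ((std_normal_density y * y ^ k) *\<^sub>R B y) \<partial>lborel)"
      unfolding eq by (intro Bochner_Integration.integral_sum integrable_scaleR_right int)
    also have "\<dots> = (\<Sum>k<N. ?d k * of_real u ^ k)"
      by (simp only: integral_scaleR_right) (simp add: scaleR_conv_of_real mult.commute)
    finally show "(\<integral>y. ?s N y \<partial>lborel) = (\<Sum>k<N. ?d k * of_real u ^ k)" .
  qed
  finally show "(\<lambda>k. ?d k * of_real u ^ k) sums
      (\<integral>y. (std_normal_density y * exp (u * y)) *\<^sub>R B y \<partial>lborel)"
    unfolding sums_def by (simp add: mult.commute)
qed

text \<open>Translating \<open>y\<close> by \<open>x / s\<close> removes \<open>x\<close> from the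
  argument of the merely measurable \<open>B\<close> and puts it into the density. Completing the
  square there leaves a Gaussian factor in \<open>x\<close> times a Laplace transform evaluated at
  \<open>x / s\<close>, both of which extend to entire functions.\<close>

lemma gaussian_smoothing_extends_entire:
  fixes B :: "real \<Rightarrow> complex"
  assumes [measurable]: "B \<in> borel_measurable borel" and B: "\<And>y. norm (B y) \<le> 1" and s: "s \<noteq> 0"
  shows "extends_entire (\<lambda>x. \<integral>y. std_normal_density y *\<^sub>R B (x + s * y) \<partial>lborel)"
proof -
  have *: "(\<integral>y. std_normal_density y *\<^sub>R B (x + s * y) \<partial>lborel)
      = exp (of_real (- 1 / (2 * s\<^sup>2)) * (of_real x * of_real x))
        * (\<integral>y. (std_normal_density y * exp ((1 / s * x) * y)) *\<^sub>R B (s * y) \<partial>lborel)" for x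
  proof -
    have "(\<integral>y. std_normal_density y *\<^sub>R B (x + s * y) \<partial>lborel)
        = (\<integral>y. std_normal_density (y - 1 / s * x) *\<^sub>R B (s * y) \<partial>lborel)"
      using s by (subst lborel_integral_real_affine[of 1 _ "- 1 / s * x"])
        (simp_all add: algebra_simps)
    also have "\<dots> = (\<integral>y. exp (- (1 / s * x)\<^sup>2 / 2) *\<^sub>R
        ((std_normal_density y * exp ((1 / s * x) * y)) *\<^sub>R B (s * y)) \<partial>lborel)"
      by (simp only: std_normal_density_shift scaleR_scaleR mult_ac)
    also have "\<dots> = exp (- (1 / s * x)\<^sup>2 / 2) *\<^sub>R
        (\<integral>y. (std_normal_density y * exp ((1 / s * x) * y)) *\<^sub>R B (s * y) \<partial>lborel)"
      by (rule integral_scaleR_right)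
    also have "- (1 / s * x)\<^sup>2 / 2 = (- 1 / (2 * s\<^sup>2)) * (x * x)"
      by (simp add: power2_eq_square)
    finally show ?thesis
      by (simp only: scaleR_conv_of_real exp_of_real[symmetric] of_real_mult)
  qed
  have "extends_entire (\<lambda>u. \<integral>y. (std_normal_density y * exp (u * y)) *\<^sub>R B (s * y) \<partial>lborel)"
    by (rule gaussian_laplace_extends_entire) (use B in simp_all)
  from extends_entire_scale[OF this, of "1 / s"] show ?thesis
    unfolding *
    by (intro extends_entire_mult extends_entire_exp extends_entire_const extends_entire_of_real)
qed

text \<open>Fubini for the product law of \<open>U\<close> and \<open>V\<close>, followed by the
  substitution that makes the normal law standard. The values of \<open>U\<close> are left general
  because it will be a whole vector of increments, of which only the combination
  \<open>\<phi>\<close> enters.\<close>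

lemma (in prob_space) expectation_indep_normal:
  fixes g :: "real \<Rightarrow> 'v \<Rightarrow> complex"
  assumes indep: "indep_var L U K V"
    and \<phi>[measurable]: "\<phi> \<in> borel_measurable L"
    and normal: "distributed M lborel (\<lambda>\<omega>. \<phi> (U \<omega>)) (normal_density 0 \<sigma>)" and \<sigma>: "\<sigma> > 0"
    and g[measurable]: "case_prod g \<in> borel_measurable (borel \<Otimes>\<^sub>M K)"
    and bound: "\<And>s v. norm (g s v) \<le> 1"
  shows "expectation (\<lambda>\<omega>. g (\<phi> (U \<omega>)) (V \<omega>))
    = (\<integral>y. std_normal_density y *\<^sub>R expectation (\<lambda>\<omega>. g (\<sigma> * y) (V \<omega>)) \<partial>lborel)"
proof -
  have U[measurable]: "U \<in> measurable M L" and V[measurable]: "V \<in> measurable M K"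
    using indep by (auto dest: indep_var_rv1 indep_var_rv2)
  interpret U: prob_space "distr M L U" by (rule prob_space_distr) simp
  interpret V: prob_space "distr M K V" by (rule prob_space_distr) simp
  interpret P: pair_prob_space "distr M L U" "distr M K V" ..
  have inner[measurable]: "(\<lambda>s. expectation (\<lambda>\<omega>. g s (V \<omega>))) \<in> borel_measurable borel"
    by measurable
  have "expectation (\<lambda>\<omega>. g (\<phi> (U \<omega>)) (V \<omega>))
      = (\<integral>z. (case z of (u, v) \<Rightarrow> g (\<phi> u) v) \<partial>distr M (L \<Otimes>\<^sub>M K) (\<lambda>\<omega>. (U \<omega>, V \<omega>)))"
    by (subst integral_distr) auto
  also have "\<dots> = (\<integral>z. (case z of (u, v) \<Rightarrow> g (\<phi> u) v) \<partial>(distr M L U \<Otimes>\<^sub>M distr M K V))"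
    using indep unfolding indep_var_distribution_eq by simp
  also have "\<dots> = (\<integral>u. (\<integral>v. g (\<phi> u) v \<partial>distr M K V) \<partial>distr M L U)"
    by (subst P.integral_fst'[symmetric])
      (auto intro!: P.integrable_const_bound[of _ 1] bound split: prod.split)
  also have "\<dots> = (\<integral>u. expectation (\<lambda>\<omega>. g (\<phi> u) (V \<omega>)) \<partial>distr M L U)"
    by (intro Bochner_Integration.integral_cong refl integral_distr) auto
  also have "\<dots> = expectation (\<lambda>\<omega>'. expectation (\<lambda>\<omega>. g (\<phi> (U \<omega>')) (V \<omega>)))"
    by (subst integral_distr) auto
  also have "\<dots> = (\<integral>s. expectation (\<lambda>\<omega>. g s (V \<omega>)) \<partial>distr M lborel (\<lambda>\<omega>. \<phi> (U \<omega>)))"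
    by (subst integral_distr) auto
  also have "distr M lborel (\<lambda>\<omega>. \<phi> (U \<omega>)) = density lborel (normal_density 0 \<sigma>)"
    by (rule distributed_distr_eq_density[OF normal])
  also have "integral\<^sup>L (density lborel (normal_density 0 \<sigma>)) (\<lambda>s. expectation (\<lambda>\<omega>. g s (V \<omega>)))
      = (\<integral>s. normal_density 0 \<sigma> s *\<^sub>R expectation (\<lambda>\<omega>. g s (V \<omega>)) \<partial>lborel)"
    by (subst integral_density) auto
  also have "\<dots> = (\<integral>y. std_normal_density y *\<^sub>R expectation (\<lambda>\<omega>. g (\<sigma> * y) (V \<omega>)) \<partial>lborel)"
  proof -
    have "\<sigma> * normal_density 0 \<sigma> (\<sigma> * y) = std_normal_density y" for y
      using \<sigma> by (simp add: normal_density_def real_sqrt_mult power_mult_distrib)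
    then show ?thesis
      using \<sigma> by (subst lborel_integral_real_affine[of \<sigma> _ 0])
        (simp_all flip: integral_scaleR_right)
  qed
  finally show ?thesis .
qed

text \<open>The identity of \<open>expectation_indep_normal\<close> is carried to the limit by
  dominated convergence, the \<open>h j\<close> being continuous and bounded by 1; the law and
  independence of the limits \<open>S\<close> and \<open>R\<close> never have to be established.
  Spaces and vectors depend on \<open>N\<close> since the number of increments grows. The second
  conclusion supplies the measurability that \<open>gaussian_smoothing_extends_entire\<close> asks
  of \<open>B\<close>.\<close>

lemma (in prob_space) expectation_indep_normal_limit:
  fixes h :: "'i \<Rightarrow> real \<Rightarrow> complex" and \<rho> :: "nat \<Rightarrow> 'i \<Rightarrow> 'v \<Rightarrow> real"
  assumes indep: "\<And>N. indep_var (L N) (U N) (K N) (V N)"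
    and \<phi>[measurable]: "\<And>N. \<phi> N \<in> borel_measurable (L N)"
    and normal: "\<And>N. distributed M lborel (\<lambda>\<omega>. \<phi> N (U N \<omega>)) (normal_density 0 (\<sigma>' N))"
    and \<sigma>': "\<And>N. \<sigma>' N > 0" "\<sigma>' \<longlonglongrightarrow> \<sigma>"
    and \<rho>: "\<And>N j. j \<in> J \<Longrightarrow> \<rho> N j \<in> borel_measurable (K N)"
    and S: "\<And>\<omega>. \<omega> \<in> space M \<Longrightarrow> (\<lambda>N. \<phi> N (U N \<omega>)) \<longlonglongrightarrow> S \<omega>"
    and R: "\<And>\<omega> j. \<omega> \<in> space M \<Longrightarrow> j \<in> J \<Longrightarrow> (\<lambda>N. \<rho> N j (V N \<omega>)) \<longlonglongrightarrow> R j \<omega>"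
    and h: "\<And>j. j \<in> J \<Longrightarrow> continuous_on UNIV (h j)" "\<And>j y. j \<in> J \<Longrightarrow> norm (h j y) \<le> 1"
  shows "expectation (\<lambda>\<omega>. \<Prod>j\<in>J. h j (x + S \<omega> + R j \<omega>))
    = (\<integral>y. std_normal_density y *\<^sub>R expectation (\<lambda>\<omega>. \<Prod>j\<in>J. h j (x + \<sigma> * y + R j \<omega>)) \<partial>lborel)"
    and "(\<lambda>z. expectation (\<lambda>\<omega>. \<Prod>j\<in>J. h j (z + R j \<omega>))) \<in> borel_measurable borel"
proof -
  have bound: "norm (\<Prod>j\<in>J. h j (f j)) \<le> 1" for f
    by (rule order_trans[OF norm_prod_le]) (auto intro!: prod_le_1 h)
  have hm: "h j \<in> borel_measurable borel" if "j \<in> J" for j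
    by (rule borel_measurable_continuous_onI[OF h(1)[OF that]])
  have Um[measurable]: "U N \<in> measurable M (L N)" and Vm[measurable]: "V N \<in> measurable M (K N)" for N
    using indep[of N] by (auto dest: indep_var_rv1 indep_var_rv2)
  have Sm[measurable]: "S \<in> borel_measurable M"
    by (rule borel_measurable_LIMSEQ_real[OF S]) auto
  have Rm: "R j \<in> borel_measurable M" if "j \<in> J" for j
    by (rule borel_measurable_LIMSEQ_real[OF R[OF _ that]]) (use \<rho>[OF that] in measurable)
  have Hm: "(\<lambda>\<omega>. \<Prod>j\<in>J. h j (f \<omega> + r j \<omega>)) \<in> borel_measurable Q"
    if [measurable]: "f \<in> borel_measurable Q" and r: "\<And>j. j \<in> J \<Longrightarrow> r j \<in> borel_measurable Q"
    for f r and Q :: "'z measure"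
    by (intro borel_measurable_prod measurable_compose[OF borel_measurable_add hm] that)
  have Hlim: "(\<lambda>N. \<Prod>j\<in>J. h j (f N + r N j)) \<longlonglongrightarrow> (\<Prod>j\<in>J. h j (f0 + r0 j))"
    if "f \<longlonglongrightarrow> f0" "\<And>j. j \<in> J \<Longrightarrow> (\<lambda>N. r N j) \<longlonglongrightarrow> r0 j" for f f0 r r0
    using that h(1)
    by (intro tendsto_prod isCont_tendsto_compose[of _ "h _"] tendsto_add)
      (auto simp: continuous_on_eq_continuous_at)
  have joint: "(\<lambda>z. expectation (\<lambda>\<omega>. \<Prod>j\<in>J. h j (z + r j \<omega>))) \<in> borel_measurable borel"
    if r: "\<And>j. j \<in> J \<Longrightarrow> r j \<in> borel_measurable M" for r
    by (rule borel_measurable_lebesgue_integral)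
      (auto simp: case_prod_beta' intro!: Hm measurable_compose[OF measurable_snd r])
  show "(\<lambda>z. expectation (\<lambda>\<omega>. \<Prod>j\<in>J. h j (z + R j \<omega>))) \<in> borel_measurable borel"
    by (rule joint[OF Rm])
  have rm: "(\<lambda>\<omega>. \<rho> N j (V N \<omega>)) \<in> borel_measurable M" if "j \<in> J" for N j
    using \<rho>[OF that] by measurable
  have eq: "expectation (\<lambda>\<omega>. \<Prod>j\<in>J. h j (x + \<phi> N (U N \<omega>) + \<rho> N j (V N \<omega>)))
    = (\<integral>y. std_normal_density y *\<^sub>R
        expectation (\<lambda>\<omega>. \<Prod>j\<in>J. h j (x + \<sigma>' N * y + \<rho> N j (V N \<omega>))) \<partial>lborel)" for N
    by (rule expectation_indep_normal[OF indep \<phi> normal \<sigma>'(1), where g = "\<lambda>s v. \<Prod>j\<in>J. h j (x + s + \<rho> N j v)"])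
      (auto simp: case_prod_beta' bound intro!: Hm measurable_compose[OF measurable_snd \<rho>])
  have "(\<lambda>N. expectation (\<lambda>\<omega>. \<Prod>j\<in>J. h j (x + \<phi> N (U N \<omega>) + \<rho> N j (V N \<omega>))))
      \<longlonglongrightarrow> expectation (\<lambda>\<omega>. \<Prod>j\<in>J. h j (x + S \<omega> + R j \<omega>))"
    by (rule integral_dominated_convergence[where w = "\<lambda>_. 1"])
      (auto intro!: AE_I2 Hm Rm rm bound Hlim tendsto_add tendsto_const S R)
  \<comment> \<open>Dominated convergence is applied twice: inside, to the expectation for fixed
    \<open>y\<close> with majorant 1, and outside, to the integral over \<open>y\<close> with the
    density as majorant.\<close>
  moreover have "(\<lambda>N. \<integral>y. std_normal_density y *\<^sub>R
        expectation (\<lambda>\<omega>. \<Prod>j\<in>J. h j (x + \<sigma>' N * y + \<rho> N j (V N \<omega>))) \<partial>lborel)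
      \<longlonglongrightarrow> (\<integral>y. std_normal_density y *\<^sub>R expectation (\<lambda>\<omega>. \<Prod>j\<in>J. h j (x + \<sigma> * y + R j \<omega>)) \<partial>lborel)"
  proof (rule integral_dominated_convergence[where w = std_normal_density])
    have ebound: "norm (expectation (\<lambda>\<omega>. \<Prod>j\<in>J. h j (f j \<omega>))) \<le> 1" for f
    proof -
      have "norm (expectation (\<lambda>\<omega>. \<Prod>j\<in>J. h j (f j \<omega>))) \<le> expectation (\<lambda>\<omega>. 1)"
        by (rule order_trans[OF integral_norm_bound])
          (intro integral_mono_AE' AE_I2 bound, auto)
      then show ?thesis by (simp add: prob_space)
    qed
    show "AE y in lborel. norm (std_normal_density y *\<^sub>R
        expectation (\<lambda>\<omega>. \<Prod>j\<in>J. h j (x + \<sigma>' N * y + \<rho> N j (V N \<omega>)))) \<le> std_normal_density y" for N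
      using ebound by (intro AE_I2) (auto intro!: mult_left_le)
    show "AE y in lborel. (\<lambda>N. std_normal_density y *\<^sub>R
        expectation (\<lambda>\<omega>. \<Prod>j\<in>J. h j (x + \<sigma>' N * y + \<rho> N j (V N \<omega>))))
        \<longlonglongrightarrow> std_normal_density y *\<^sub>R expectation (\<lambda>\<omega>. \<Prod>j\<in>J. h j (x + \<sigma> * y + R j \<omega>))"
      by (intro AE_I2 tendsto_scaleR tendsto_const integral_dominated_convergence[where w = "\<lambda>_. 1"])
        (auto intro!: AE_I2 Hm Rm rm bound Hlim tendsto_add tendsto_mult tendsto_const \<sigma>' R)
    show "(\<lambda>y. std_normal_density y *\<^sub>R expectation (\<lambda>\<omega>. \<Prod>j\<in>J. h j (x + \<sigma> * y + R j \<omega>)))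
        \<in> borel_measurable lborel"
      by (intro borel_measurable_scaleR measurable_compose[OF _ joint[OF Rm]]) auto
    show "(\<lambda>y. std_normal_density y *\<^sub>R
        expectation (\<lambda>\<omega>. \<Prod>j\<in>J. h j (x + \<sigma>' N * y + \<rho> N j (V N \<omega>)))) \<in> borel_measurable lborel" for N
      by (intro borel_measurable_scaleR measurable_compose[OF _ joint[OF rm]]) auto
  qed simp
  ultimately show "expectation (\<lambda>\<omega>. \<Prod>j\<in>J. h j (x + S \<omega> + R j \<omega>))
    = (\<integral>y. std_normal_density y *\<^sub>R expectation (\<lambda>\<omega>. \<Prod>j\<in>J. h j (x + \<sigma> * y + R j \<omega>)) \<partial>lborel)"
    unfolding eq by (rule LIMSEQ_unique)
qed

section \<open>Wiener integrals of exponentials\<close>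

text \<open>The Wiener integral of \<open>exp (- b r)\<close> over \<open>[u, s]\<close> along the path \<open>w\<close>, defined
  pathwise through integration by parts.\<close>

definition exp_wiener_integral :: "real \<Rightarrow> (real \<Rightarrow> real) \<Rightarrow> real \<Rightarrow> real \<Rightarrow> real" where
  "exp_wiener_integral b w u s =
     exp (- b * s) * w s - exp (- b * u) * w u - integral {u..s} (\<lambda>r. - b * exp (- b * r) * w r)"

lemma exp_wiener_integral_combine:
  assumes "u \<le> s" "s \<le> r" "continuous_on {u..r} w"
  shows "exp_wiener_integral b w u s + exp_wiener_integral b w s r = exp_wiener_integral b w u r"
proof -
  have "integral {u..s} (\<lambda>r. - b * exp (- b * r) * w r) + integral {s..r} (\<lambda>r. - b * exp (- b * r) * w r)
      = integral {u..r} (\<lambda>r. - b * exp (- b * r) * w r)"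
    by (intro Henstock_Kurzweil_Integration.integral_combine integrable_continuous_real
        continuous_intros assms)
  then show ?thesis unfolding exp_wiener_integral_def by linarith
qed

text \<open>It serves twice: along a Brownian path the left-endpoint sums are linear combinations of
  independent increments, and along the identity path, with \<open>2 * b\<close> for
  \<open>b\<close>, they are the variances of such combinations.\<close>

lemma exp_wiener_integral_sum_tendsto:
  assumes "u \<le> s" "continuous_on {u..s} w"
  shows "(\<lambda>N. \<Sum>k<N. exp (- b * (u + real k * (s - u) / real N))
            * (w (u + real (Suc k) * (s - u) / real N) - w (u + real k * (s - u) / real N)))
           \<longlonglongrightarrow> exp_wiener_integral b w u s"
  unfolding exp_wiener_integral_def
  by (rule riemann_stieltjes_sum_tendsto[OF assms(1) _ _ assms(2)])
    (auto intro!: derivative_eq_intros continuous_intros)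

text \<open>Increments over a grid of \<open>[t, s]\<close> form \<open>U\<close>, those over a grid
  of the later intervals form \<open>V\<close>. The Riemann sums from \<open>U\<close> are normal
  with variance \<open>\<sigma>2 N\<close>, which tends to \<open>v > 0\<close>. In the limit the
  integral over \<open>[t, s]\<close> acts as Gaussian smoothing of \<open>B\<close>, the
  expectation that keeps only the integrals after \<open>s\<close>.\<close>

lemma (in prob_space) brownian_gaussian_smoothing:
  fixes W :: "real \<Rightarrow> 'a \<Rightarrow> real" and h :: "nat \<Rightarrow> real \<Rightarrow> complex"
  assumes BM: "brownian_motion M W"
    and t: "0 \<le> t" "t < s" and \<delta>: "\<delta> > 0"
    and h: "\<And>j. j \<le> m \<Longrightarrow> continuous_on UNIV (h j)" "\<And>j y. j \<le> m \<Longrightarrow> norm (h j y) \<le> 1"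
  shows "extends_entire (\<lambda>x. expectation (\<lambda>\<omega>. \<Prod>j\<le>m. h j (x
    + exp_wiener_integral b (\<lambda>r. W r \<omega>) t s
    + exp_wiener_integral b (\<lambda>r. W r \<omega>) s (s + real j * \<delta>))))"
proof -
  \<comment> \<open>\<open>Suc N\<close> cells fill \<open>[t, s]\<close>, then cells of length
    \<open>\<delta> / real (Suc N)\<close> follow, so that every
    \<open>s + real j * \<delta>\<close> is the grid point of index
    \<open>Suc N + j * Suc N\<close>. Using \<open>Suc N\<close> avoids division by zero.\<close>
  define ts where "ts N k = (if k \<le> Suc N then t + real k * (s - t) / real (Suc N)
      else s + real (k - Suc N) * \<delta> / real (Suc N))" for N k
  define n where "n N = Suc N + m * Suc N" for N
  define D where "D N k \<omega> = W (ts N (Suc k)) \<omega> - W (ts N k) \<omega>" for N k \<omega>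
  define U where "U N \<omega> = restrict (\<lambda>k. D N k \<omega>) {..<Suc N}" for N \<omega>
  define V where "V N \<omega> = restrict (\<lambda>k. D N k \<omega>) {Suc N..<n N}" for N \<omega>
  define \<phi> where "\<phi> N v = (\<Sum>k<Suc N. exp (- b * ts N k) * v k)" for N and v :: "nat \<Rightarrow> real"
  define \<rho> where "\<rho> N j v = (\<Sum>k<j * Suc N. exp (- b * ts N (Suc N + k)) * v (Suc N + k))"
    for N j and v :: "nat \<Rightarrow> real"
  define \<sigma>2 where "\<sigma>2 N = (\<Sum>k<Suc N. exp (- (2 * b) * ts N k) * (ts N (Suc k) - ts N k))" for N
  \<comment> \<open>This is the integral of \<open>exp (- (2 * b) * r)\<close> over
    \<open>[t, s]\<close>, the variance given by the Ito isometry, written as an integral along the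
    identity path.\<close>
  define v where "v = exp_wiener_integral (2 * b) (\<lambda>r. r) t s"

  have ts0: "ts N 0 = t" for N by (simp add: ts_def)
  have ts_left: "ts N k = t + real k * (s - t) / real (Suc N)" if "k \<le> Suc N" for N k
    using that by (simp add: ts_def)
  \<comment> \<open>For \<open>k = 0\<close> the index still falls into the first branch of
    \<open>ts\<close>; both formulas give \<open>s\<close> there.\<close>
  have ts_right: "ts N (Suc N + k) = s + real k * \<delta> / real (Suc N)" for N k
    by (cases k) (auto simp: ts_def)
  have ts_less: "ts N k < ts N (Suc k)" for N k
  proof (cases "k < Suc N")
    case True
    then show ?thesis using t by (auto simp: ts_left divide_strict_right_mono)
  next
    case False
    then obtain l where "k = Suc N + l" by (metis le_Suc_ex not_less)
    then show ?thesis
      using \<delta> ts_right[of N l] ts_right[of N "Suc l"] by (auto simp: divide_strict_right_mono)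
  qed
  have ts_ge: "t \<le> ts N k" for N k
    by (induction k) (use ts0 ts_less less_imp_le order_trans in \<open>auto, blast\<close>)
  have ts_le: "ts N k \<le> s" if "k \<le> Suc N" for N k
  proof -
    have "mono (ts N)" using ts_less by (intro incseq_SucI less_imp_le)
    then have "ts N k \<le> ts N (Suc N)" using that by (rule monoD)
    then show ?thesis using ts_left[of "Suc N" N] by simp
  qed

  have cont: "continuous_on {u..} (\<lambda>r. W r \<omega>)" if "\<omega> \<in> space M" "0 \<le> u" for \<omega> u
    using BM that unfolding brownian_motion_def by (meson atLeast_subset_iff continuous_on_subset)
  have D_normal: "distributed M lborel (D N k) (normal_density 0 (sqrt (ts N (Suc k) - ts N k)))" for N k
  proof -
    have "0 \<le> ts N k \<and> ts N k < ts N (Suc k)" using ts_ge[of N k] t ts_less by auto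
    then show ?thesis using BM unfolding brownian_motion_def D_def[abs_def] by blast
  qed
  have D_indep: "indep_vars (\<lambda>_. borel) (D N) {..<n N}" for N
  proof -
    have "0 \<le> ts N 0 \<and> (\<forall>i<n N. ts N i < ts N (Suc i))" using ts0 t ts_less by auto
    then show ?thesis using BM unfolding brownian_motion_def D_def[abs_def] by blast
  qed
  have UV: "indep_var (PiM {..<Suc N} (\<lambda>_. borel)) (U N) (PiM {Suc N..<n N} (\<lambda>_. borel)) (V N)" for N
    unfolding U_def[abs_def] V_def[abs_def]
    by (rule indep_var_restrict[OF D_indep]) (auto simp: n_def)
  have \<phi>U: "\<phi> N (U N \<omega>) = (\<Sum>k<Suc N. exp (- b * ts N k) * D N k \<omega>)" for N \<omega>
    unfolding \<phi>_def U_def by (intro sum.cong) auto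
  \<comment> \<open>The bound on \<open>j\<close> keeps all indices below \<open>n N\<close>;
    outside that range the restricted vector \<open>V\<close> is \<open>undefined\<close>.\<close>
  have \<rho>V: "\<rho> N j (V N \<omega>) = (\<Sum>k<j * Suc N. exp (- b * ts N (Suc N + k)) * D N (Suc N + k) \<omega>)"
    if "j \<le> m" for N j \<omega>
    unfolding \<rho>_def V_def
  proof (intro sum.cong refl)
    fix k assume k: "k \<in> {..<j * Suc N}"
    have "j * Suc N \<le> m * Suc N" using that by (rule mult_le_mono1)
    then have "Suc N + k \<in> {Suc N..<n N}" using k unfolding n_def by auto
    then show "exp (- b * ts N (Suc N + k)) * restrict (\<lambda>k. D N k \<omega>) {Suc N..<n N} (Suc N + k)
        = exp (- b * ts N (Suc N + k)) * D N (Suc N + k) \<omega>" by simp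
  qed
  have \<sigma>2_pos: "\<sigma>2 N > 0" for N
    unfolding \<sigma>2_def using ts_less by (intro sum_pos) auto
  have \<phi>_normal: "distributed M lborel (\<lambda>\<omega>. \<phi> N (U N \<omega>)) (normal_density 0 (sqrt (\<sigma>2 N)))" for N
  proof -
    have "distributed M lborel (\<lambda>\<omega>. \<Sum>k<Suc N. exp (- b * ts N k) * D N k \<omega>)
      (normal_density (\<Sum>k<Suc N. 0) (sqrt (\<Sum>k<Suc N. (exp (- b * ts N k) * sqrt (ts N (Suc k) - ts N k))\<^sup>2)))"
    proof (rule sum_indep_normal)
      have "indep_vars (\<lambda>_. borel) (D N) {..<Suc N}"
        by (rule indep_vars_subset[OF D_indep]) (auto simp: n_def)
      then show "indep_vars (\<lambda>_. borel) (\<lambda>k \<omega>. exp (- b * ts N k) * D N k \<omega>) {..<Suc N}"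
        by (rule indep_vars_compose2) auto
      show "distributed M lborel (\<lambda>\<omega>. exp (- b * ts N k) * D N k \<omega>)
          (normal_density 0 (exp (- b * ts N k) * sqrt (ts N (Suc k) - ts N k)))" for k
        using normal_density_affine[OF D_normal, of N k "exp (- b * ts N k)" 0] ts_less by simp
    qed (use ts_less in auto)
    moreover have "(exp (- b * ts N k) * sqrt (ts N (Suc k) - ts N k))\<^sup>2
        = exp (- (2 * b) * ts N k) * (ts N (Suc k) - ts N k)" for k
    proof -
      have "exp (- b * ts N k) * exp (- b * ts N k) = exp (- (2 * b) * ts N k)"
        by (simp flip: exp_add)
      then show ?thesis
        using ts_less[of N k] by (simp add: power_mult_distrib) (simp add: power2_eq_square)
    qed
    ultimately show ?thesis unfolding \<phi>U \<sigma>2_def by simp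
  qed
  have \<sigma>2_lim: "\<sigma>2 \<longlonglongrightarrow> v"
  proof -
    have "(\<lambda>N. \<Sum>k<Suc N. exp (- (2 * b) * (t + real k * (s - t) / real (Suc N)))
        * ((t + real (Suc k) * (s - t) / real (Suc N)) - (t + real k * (s - t) / real (Suc N)))) \<longlonglongrightarrow> v"
      unfolding v_def
      by (rule LIMSEQ_Suc[OF exp_wiener_integral_sum_tendsto[of t s "\<lambda>r. r"]]) (use t in auto)
    then show ?thesis
      unfolding \<sigma>2_def[abs_def]
      by (rule Lim_transform_eventually) (auto intro!: always_eventually sum.cong simp: ts_left)
  qed
  have v_pos: "v > 0"
  proof -
    \<comment> \<open>Positivity of each \<open>\<sigma>2 N\<close> is not inherited by the limit,
      so a bound uniform in \<open>N\<close> is used: |b| s bounds b r for all r in [0, s].\<close>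
    have "exp (- (2 * \<bar>b\<bar> * s)) * (s - t) \<le> \<sigma>2 N" for N
    proof -
      have "exp (- (2 * \<bar>b\<bar> * s)) * (s - t) = (\<Sum>k<Suc N. exp (- (2 * \<bar>b\<bar> * s)) * (ts N (Suc k) - ts N k))"
        unfolding sum_distrib_left[symmetric] sum_lessThan_telescope
        using ts_left[of "Suc N" N] by (simp add: ts0)
      also have "\<dots> \<le> \<sigma>2 N"
        unfolding \<sigma>2_def
      proof (intro sum_mono mult_right_mono)
        fix k assume "k \<in> {..<Suc N}"
        then have "0 \<le> ts N k" "ts N k \<le> s" using ts_ge[of N k] ts_le[of k N] t by auto
        then have "b * ts N k \<le> \<bar>b\<bar> * s" by (intro mult_mono) auto
        then show "exp (- (2 * \<bar>b\<bar> * s)) \<le> exp (- (2 * b) * ts N k)" by simp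
      qed (use ts_less less_imp_le in auto)
      finally show ?thesis .
    qed
    then have "exp (- (2 * \<bar>b\<bar> * s)) * (s - t) \<le> v"
      by (intro LIMSEQ_le_const[OF \<sigma>2_lim]) auto
    moreover have "0 < exp (- (2 * \<bar>b\<bar> * s)) * (s - t)" using t by simp
    ultimately show ?thesis by linarith
  qed
  have S_lim: "(\<lambda>N. \<phi> N (U N \<omega>)) \<longlonglongrightarrow> exp_wiener_integral b (\<lambda>r. W r \<omega>) t s"
    if "\<omega> \<in> space M" for \<omega>
  proof -
    have "continuous_on {t..s} (\<lambda>r. W r \<omega>)"
      by (rule continuous_on_subset[OF cont[OF that t(1)]]) auto
    from LIMSEQ_Suc[OF exp_wiener_integral_sum_tendsto[OF less_imp_le[OF t(2)] this, of b]]
    show ?thesis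
      by (rule Lim_transform_eventually)
        (auto intro!: always_eventually sum.cong simp: \<phi>U D_def ts_left simp del: sum.lessThan_Suc)
  qed
  have R_lim: "(\<lambda>N. \<rho> N j (V N \<omega>)) \<longlonglongrightarrow> exp_wiener_integral b (\<lambda>r. W r \<omega>) s (s + real j * \<delta>)"
    if \<omega>: "\<omega> \<in> space M" and j: "j \<le> m" for \<omega> j
  \<comment> \<open>The grid on \<open>[s, s + real j * \<delta>]\<close> has
    \<open>j * Suc N\<close> cells, so the convergence is that of a subsequence of uniform
    partitions. This index map is strictly increasing only for \<open>j\<close> nonzero; for
    \<open>j = 0\<close> both sides vanish.\<close>
  proof (cases "j = 0")
    case True
    then show ?thesis by (simp add: exp_wiener_integral_def \<rho>_def)
  next
    case False
    have "continuous_on {s..s + real j * \<delta>} (\<lambda>r. W r \<omega>)"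
      by (rule continuous_on_subset[OF cont[OF \<omega>, of s]]) (use t in auto)
    moreover have "s \<le> s + real j * \<delta>" using \<delta> by simp
    moreover have "strict_mono (\<lambda>N. j * Suc N)"
      using False by (auto simp: strict_mono_Suc_iff)
    ultimately have "((\<lambda>N. \<Sum>k<N. exp (- b * (s + real k * (s + real j * \<delta> - s) / real N))
            * (W (s + real (Suc k) * (s + real j * \<delta> - s) / real N) \<omega>
               - W (s + real k * (s + real j * \<delta> - s) / real N) \<omega>)) \<circ> (\<lambda>N. j * Suc N))
           \<longlonglongrightarrow> exp_wiener_integral b (\<lambda>r. W r \<omega>) s (s + real j * \<delta>)"
      by (intro LIMSEQ_subseq_LIMSEQ exp_wiener_integral_sum_tendsto)
    moreover have "real k * (s + real j * \<delta> - s) / real (j * Suc N) = real k * \<delta> / real (Suc N)" for k N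
    proof -
      have "real k * (s + real j * \<delta> - s) = real j * (real k * \<delta>)" by simp
      then show ?thesis using False by (simp only: of_nat_mult mult_divide_mult_cancel_left)
    qed
    ultimately have "(\<lambda>N. \<Sum>k<j * Suc N. exp (- b * (s + real k * \<delta> / real (Suc N)))
            * (W (s + real (Suc k) * \<delta> / real (Suc N)) \<omega> - W (s + real k * \<delta> / real (Suc N)) \<omega>))
           \<longlonglongrightarrow> exp_wiener_integral b (\<lambda>r. W r \<omega>) s (s + real j * \<delta>)"
      by (simp only: comp_def)
    moreover have "ts N (Suc (Suc N + k)) = s + real (Suc k) * \<delta> / real (Suc N)" for N k
      using ts_right[of N "Suc k"] by simp
    ultimately show ?thesis
      unfolding \<rho>V[OF j] D_def ts_right by simp
  qed
  have \<phi>_meas: "\<phi> N \<in> borel_measurable (PiM {..<Suc N} (\<lambda>_. borel))" for N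
    unfolding \<phi>_def by (intro borel_measurable_sum borel_measurable_times) auto
  have \<rho>_meas: "\<rho> N j \<in> borel_measurable (PiM {Suc N..<n N} (\<lambda>_. borel))" if "j \<le> m" for N j
    unfolding \<rho>_def
  proof (intro borel_measurable_sum borel_measurable_times)
    fix k assume k: "k \<in> {..<j * Suc N}"
    have "j * Suc N \<le> m * Suc N" using that by (rule mult_le_mono1)
    then have "Suc N + k \<in> {Suc N..<n N}" using k unfolding n_def by auto
    then show "(\<lambda>v. v (Suc N + k)) \<in> borel_measurable (PiM {Suc N..<n N} (\<lambda>_. borel))"
      by (rule measurable_component_singleton)
  qed auto
  define B where "B z = expectation (\<lambda>\<omega>. \<Prod>j\<le>m. h j (z +
    exp_wiener_integral b (\<lambda>r. W r \<omega>) s (s + real j * \<delta>)))" for z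
  have \<sigma>_lim: "(\<lambda>N. sqrt (\<sigma>2 N)) \<longlonglongrightarrow> sqrt v"
    by (intro tendsto_intros \<sigma>2_lim)
  note lim = expectation_indep_normal_limit[where J = "{..m}" and h = h and \<rho> = \<rho>
      and R = "\<lambda>j \<omega>. exp_wiener_integral b (\<lambda>r. W r \<omega>) s (s + real j * \<delta>)",
      OF UV \<phi>_meas \<phi>_normal _ \<sigma>_lim _ S_lim]
  have "extends_entire (\<lambda>x. \<integral>y. std_normal_density y *\<^sub>R B (x + sqrt v * y) \<partial>lborel)"
  proof (rule gaussian_smoothing_extends_entire)
    show "B \<in> borel_measurable borel"
      unfolding B_def[abs_def] by (rule lim(2)) (use \<sigma>2_pos \<rho>_meas R_lim h in auto)
    show "norm (B z) \<le> 1" for z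
    proof -
      have "norm (B z) \<le> expectation (\<lambda>\<omega>. 1)"
        unfolding B_def
      proof (rule order_trans[OF integral_norm_bound], intro integral_mono_AE' AE_I2)
        show "norm (\<Prod>j\<le>m. h j (f j)) \<le> 1" for f
          by (rule order_trans[OF norm_prod_le]) (auto intro!: prod_le_1 h)
      qed auto
      then show ?thesis by (simp add: prob_space)
    qed
    show "sqrt v \<noteq> 0" using v_pos by simp
  qed
  moreover have "expectation (\<lambda>\<omega>. \<Prod>j\<le>m. h j (x + exp_wiener_integral b (\<lambda>r. W r \<omega>) t s
      + exp_wiener_integral b (\<lambda>r. W r \<omega>) s (s + real j * \<delta>)))
    = (\<integral>y. std_normal_density y *\<^sub>R B (x + sqrt v * y) \<partial>lborel)" for x
    unfolding B_def by (rule lim(1)) (use \<sigma>2_pos \<rho>_meas R_lim h in auto)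
  ultimately show ?thesis by simp
qed

section \<open>Reduction of the expectation to Gaussian smoothing\<close>

theorem theorem7p3:
  fixes M :: "'a measure" and W :: "real \<Rightarrow> 'a \<Rightarrow> real"
    and a b c T t :: real and n :: nat
    and u1 u2 u3 v :: "real \<Rightarrow> complex"
    and p p2 p3 q :: "nat \<Rightarrow> real"
    and X :: "real \<Rightarrow> real \<Rightarrow> 'a \<Rightarrow> real"
  assumes BM: "brownian_motion M W"
    and c: "c \<noteq> 0" and T: "T > 0"
    and n: "n \<ge> 1" and t: "t \<in> {0..T}"
    and X_sol: "\<And>x \<omega>. \<omega> \<in> space M \<Longrightarrow>
         continuous_on {t..T} (\<lambda>s. X x s \<omega>) \<and>
         (\<forall>s\<in>{t..T}. X x s \<omega> = x + integral {t..s} (\<lambda>r. a + b * X x r \<omega>) + c * (W s \<omega> - W t \<omega>))"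
    and cont: "continuous_on {0..T} u1" "continuous_on {0..T} u2"
      "continuous_on {0..T} u3" "continuous_on {0..T} v"
    and re: "\<forall>s\<in>{0..T}. Re (u1 s) \<le> 0 \<and> Re (u2 s) = 0 \<and> Re (u3 s) = 0 \<and> Re (v s) = 0"
    and negl: "negligible_dfact p" "negligible_dfact p2" "negligible_dfact p3" "negligible_dfact q"
  shows "\<exists>cf :: nat \<Rightarrow> complex. \<forall>x :: real.
           (\<lambda>k. cf k * of_real x ^ k) sums fn M X T u1 u2 u3 v (pser_sq p) p2 p3 q n t x"
proof -
  interpret prob_space M using BM unfolding brownian_motion_def by blast
  define \<delta> where "\<delta> = T / real n"
  have \<delta>: "\<delta> > 0" and n\<delta>: "real n * \<delta> = T" using T n by (auto simp: \<delta>_def)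
  define E where "E s y = exp (of_real \<delta> * (u1 s * of_real (pser (pser_sq p) y)
      + u2 s * of_real (pser p2 y) + u3 s * of_real (pser p3 y)))" for s y
  define Q where "Q y = exp (v T * of_real (pser q y))" for y
  define I where "I = {i. i < n \<and> t \<le> real i * \<delta>}"
  have fin: "finite I" unfolding I_def by auto
  have E_ext: "extends_entire (E s)" for s
  proof -
    have "extends_entire (\<lambda>y. of_real (pser (pser_sq p) y))"
      unfolding pser_sq[OF negl(1)] power2_eq_square of_real_mult
      by (intro extends_entire_mult extends_entire_pser negl)
    then show ?thesis
      unfolding E_def[abs_def]
      by (intro extends_entire_exp extends_entire_mult extends_entire_add extends_entire_const
          extends_entire_pser[OF negl(2)] extends_entire_pser[OF negl(3)])
  qed
  have Q_ext: "extends_entire Q"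
    unfolding Q_def[abs_def]
    by (intro extends_entire_exp extends_entire_mult extends_entire_const extends_entire_pser negl)
  have E_norm: "norm (E s y) \<le> 1" if "s \<in> {0..T}" for s y
  proof -
    have "Re (u1 s) * (pser p y)\<^sup>2 \<le> 0" using re that by (intro mult_nonpos_nonneg) auto
    then show ?thesis
      using re that \<delta> unfolding E_def norm_exp_eq_Re pser_sq[OF negl(1)]
      by (simp add: mult_nonneg_nonpos)
  qed
  have Q_norm: "norm (Q y) \<le> 1" for y
    using re T unfolding Q_def norm_exp_eq_Re by simp
  have fn_eq: "fn M X T u1 u2 u3 v (pser_sq p) p2 p3 q n t x
      = expectation (\<lambda>\<omega>. (\<Prod>i\<in>I. E (real i * \<delta>) (X x (real i * \<delta>) \<omega>)) * Q (X x T \<omega>))" for x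
    unfolding fn_def mu_int_def exp_add E_def Q_def I_def
    by (simp add: exp_sum sum_distrib_left \<delta>_def)
  have X_t: "X x t \<omega> = x" if "\<omega> \<in> space M" for x \<omega>
    using X_sol[OF that] t by simp
  have "extends_entire (fn M X T u1 u2 u3 v (pser_sq p) p2 p3 q n t)"
  \<comment> \<open>At \<open>t = T\<close> there is no later interval to smooth over, but also no
    randomness: the grid indices stop at \<open>n - 1\<close>, so no grid point is left and only the
    terminal factor at \<open>X = x\<close> remains.\<close>
  proof (cases "t = T")
    case True
    have "real i * \<delta> < T" if "i < n" for i
    proof -
      have "real i * \<delta> < real n * \<delta>" using that \<delta> by simp
      then show ?thesis using n\<delta> by simp
    qed
    then have "I = {}" unfolding I_def True by force
    then have "fn M X T u1 u2 u3 v (pser_sq p) p2 p3 q n t x = Q x" for x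
    proof -
      have "fn M X T u1 u2 u3 v (pser_sq p) p2 p3 q n t x = expectation (\<lambda>\<omega>. Q x)"
        unfolding fn_eq \<open>I = {}\<close>
        by (intro Bochner_Integration.integral_cong) (use X_t True in auto)
      then show ?thesis by (simp add: prob_space)
    qed
    then have "fn M X T u1 u2 u3 v (pser_sq p) p2 p3 q n t = Q" by (rule ext)
    then show ?thesis using Q_ext by simp
  next
    case False
    then have tT: "t < T" using t by auto
    \<comment> \<open>Strictness ensures \<open>t < s\<close>, hence a positive Gaussian variance.
      The value \<open>i0 = n\<close> is possible; then \<open>s = T\<close>, \<open>m = 0\<close>
      and only the terminal factor follows.\<close>
    define i0 where "i0 = (LEAST i. t < real i * \<delta>)"
    have i0: "t < real i0 * \<delta>" and i0_le: "i0 \<le> n"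
      unfolding i0_def using tT n\<delta> by (auto intro: LeastI Least_le)
    have i0_least: "t < real i * \<delta> \<longleftrightarrow> i0 \<le> i" for i
    proof
      assume "i0 \<le> i"
      then have "real i0 * \<delta> \<le> real i * \<delta>" using \<delta> by simp
      then show "t < real i * \<delta>" using i0 by simp
    qed (auto simp: i0_def intro: Least_le)
    define s where "s = real i0 * \<delta>"
    define m where "m = n - i0"
    \<comment> \<open>At most one index: the grid point \<open>t\<close> itself, if present. There
      \<open>X\<close> equals the deterministic \<open>x\<close>, so its factor \<open>G x\<close>
      leaves the expectation.\<close>
    define A where "A = {i \<in> I. real i * \<delta> = t}"
    have sj: "s + real j * \<delta> = real (i0 + j) * \<delta>" for j
      by (simp add: s_def algebra_simps)
    have sm: "s + real m * \<delta> = T" using i0_le n\<delta> unfolding sj m_def by simp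
    have sj_le: "s + real j * \<delta> \<le> T" if "j \<le> m" for j
      using that \<delta> sm by (smt (verit) mult_right_mono of_nat_le_iff)
    have s: "t < s" "0 \<le> t" "0 \<le> s" using i0 t by (auto simp: s_def)
    have I_split: "I = A \<union> (\<lambda>j. i0 + j) ` {..<m}"
    proof -
      have "I = A \<union> {i0..<n}"
      proof (rule set_eqI)
        fix i
        show "i \<in> I \<longleftrightarrow> i \<in> A \<union> {i0..<n}"
          using i0_least[of i] by (auto simp: A_def I_def)
      qed
      also have "{i0..<n} = (\<lambda>j. i0 + j) ` {..<m}"
        using i0_le image_add_atLeastLessThan[of i0 0 m] by (simp add: m_def lessThan_atLeast0)
      finally show ?thesis .
    qed
    have disj: "A \<inter> (\<lambda>j. i0 + j) ` {..<m} = {}"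
    proof -
      have "real (i0 + j) * \<delta> \<noteq> t" for j
        using i0_least[of "i0 + j"] by simp
      then show ?thesis unfolding A_def by blast
    qed
    \<comment> \<open>Index \<open>m\<close> stands for the time \<open>T\<close>, which carries no
      mass of the discrete measure and contributes the terminal factor \<open>Q\<close>
      instead.\<close>
    define k where "k j y = (if j < m then E (s + real j * \<delta>) y else Q y)" for j y
    define \<alpha> where "\<alpha> j = integral {t..s + real j * \<delta>} (\<lambda>r. a * exp (- b * r))" for j
    define h where "h j z = k j (exp (b * (s + real j * \<delta>)) * (\<alpha> j + c * z))" for j :: nat and z
    define G where "G x = (\<Prod>i\<in>A. E t x)" for x
    let ?Y = "\<lambda>x \<omega> j. x + exp_wiener_integral b (\<lambda>r. W r \<omega>) t s
      + exp_wiener_integral b (\<lambda>r. W r \<omega>) s (s + real j * \<delta>)"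
    \<comment> \<open>Dividing the starting term by \<open>c\<close> puts it inside the bracket
      multiplied by \<open>c\<close>, so that the scaled \<open>x\<close> acts as a translation of
      the Wiener integral, as the smoothing lemma requires.\<close>
    have X_eq: "X x (s + real j * \<delta>) \<omega>
        = exp (b * (s + real j * \<delta>)) * (\<alpha> j + c * ?Y (exp (- b * t) / c * x) \<omega> j)"
      if \<omega>: "\<omega> \<in> space M" and j: "j \<le> m" for x \<omega> j
    proof -
      have cW: "continuous_on {0..} (\<lambda>r. W r \<omega>)"
        using BM \<omega> unfolding brownian_motion_def by blast
      have le: "s \<le> s + real j * \<delta>" using \<delta> by simp
      have comb: "exp_wiener_integral b (\<lambda>r. W r \<omega>) t s + exp_wiener_integral b (\<lambda>r. W r \<omega>) s (s + real j * \<delta>)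
          = exp_wiener_integral b (\<lambda>r. W r \<omega>) t (s + real j * \<delta>)"
        using s le by (intro exp_wiener_integral_combine continuous_on_subset[OF cW]) auto
      have "X x (s + real j * \<delta>) \<omega> = exp (b * (s + real j * \<delta>)) *
          (exp (- b * t) * x + \<alpha> j + c * exp_wiener_integral b (\<lambda>r. W r \<omega>) t (s + real j * \<delta>))"
        unfolding \<alpha>_def exp_wiener_integral_def
        by (rule linear_integral_equation_solution[where T = T])
          (use X_sol[OF \<omega>, of x] s le sj_le[OF j] in \<open>auto intro: continuous_on_subset[OF cW]\<close>)
      also have "exp (- b * t) * x + \<alpha> j + c * exp_wiener_integral b (\<lambda>r. W r \<omega>) t (s + real j * \<delta>)
          = \<alpha> j + c * ?Y (exp (- b * t) / c * x) \<omega> j"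
        unfolding comb[symmetric] using c by (simp add: field_simps)
      finally show ?thesis .
    qed
    have integrand: "(\<Prod>i\<in>I. E (real i * \<delta>) (X x (real i * \<delta>) \<omega>)) * Q (X x T \<omega>)
        = G x * (\<Prod>j\<le>m. h j (?Y (exp (- b * t) / c * x) \<omega> j))" if \<omega>: "\<omega> \<in> space M" for x \<omega>
    proof -
      have "(\<Prod>i\<in>I. E (real i * \<delta>) (X x (real i * \<delta>) \<omega>))
          = (\<Prod>i\<in>A. E (real i * \<delta>) (X x (real i * \<delta>) \<omega>))
            * (\<Prod>i\<in>(\<lambda>j. i0 + j) ` {..<m}. E (real i * \<delta>) (X x (real i * \<delta>) \<omega>))"
        unfolding I_split by (rule prod.union_disjoint) (use fin disj in \<open>auto simp: A_def\<close>)
      also have "(\<Prod>i\<in>A. E (real i * \<delta>) (X x (real i * \<delta>) \<omega>)) = G x"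
        unfolding G_def by (intro prod.cong refl) (auto simp: A_def X_t[OF \<omega>])
      also have "(\<Prod>i\<in>(\<lambda>j. i0 + j) ` {..<m}. E (real i * \<delta>) (X x (real i * \<delta>) \<omega>))
          = (\<Prod>j<m. k j (X x (s + real j * \<delta>) \<omega>))"
        by (subst prod.reindex) (auto simp: k_def sj intro!: prod.cong)
      also have "G x * (\<Prod>j<m. k j (X x (s + real j * \<delta>) \<omega>)) * Q (X x T \<omega>)
          = G x * (\<Prod>j\<le>m. k j (X x (s + real j * \<delta>) \<omega>))"
        unfolding lessThan_Suc_atMost[symmetric] by (simp add: k_def sm)
      also have "(\<Prod>j\<le>m. k j (X x (s + real j * \<delta>) \<omega>))
          = (\<Prod>j\<le>m. h j (?Y (exp (- b * t) / c * x) \<omega> j))"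
        unfolding h_def by (intro prod.cong refl) (simp only: X_eq[OF \<omega>] atMost_iff)
      finally show ?thesis .
    qed
    have "fn M X T u1 u2 u3 v (pser_sq p) p2 p3 q n t
        = (\<lambda>x. G x * expectation (\<lambda>\<omega>. \<Prod>j\<le>m. h j (?Y (exp (- b * t) / c * x) \<omega> j)))"
    proof
      fix x
      have "fn M X T u1 u2 u3 v (pser_sq p) p2 p3 q n t x
          = expectation (\<lambda>\<omega>. G x * (\<Prod>j\<le>m. h j (?Y (exp (- b * t) / c * x) \<omega> j)))"
        unfolding fn_eq by (intro Bochner_Integration.integral_cong refl integrand)
      then show "fn M X T u1 u2 u3 v (pser_sq p) p2 p3 q n t x
          = G x * expectation (\<lambda>\<omega>. \<Prod>j\<le>m. h j (?Y (exp (- b * t) / c * x) \<omega> j))"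
        by (simp only: integral_mult_right_zero)
    qed
    moreover have "extends_entire G"
    proof -
      have "extends_entire (\<lambda>x. E t x ^ d)" for d
        by (induction d) (auto intro: extends_entire_const extends_entire_mult[OF E_ext])
      then show ?thesis unfolding G_def[abs_def] prod_constant .
    qed
    moreover have "extends_entire (\<lambda>x. expectation (\<lambda>\<omega>. \<Prod>j\<le>m. h j (?Y x \<omega> j)))"
    proof (rule brownian_gaussian_smoothing[OF BM s(2) s(1) \<delta>])
      fix j assume j: "j \<le> m"
      have "continuous_on UNIV (k j)"
        unfolding k_def[abs_def]
        using extends_entire_imp_continuous[OF E_ext] extends_entire_imp_continuous[OF Q_ext]
        by (cases "j < m") simp_all
      then show "continuous_on UNIV (h j)"
        unfolding h_def[abs_def] by (rule continuous_on_compose2) (auto intro!: continuous_intros)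
      show "norm (h j y) \<le> 1" for y
        unfolding h_def k_def using E_norm Q_norm sj_le[OF j] s \<delta> by auto
    qed
    from extends_entire_scale[OF this, of "exp (- b * t) / c"]
    have "extends_entire (\<lambda>x. expectation (\<lambda>\<omega>. \<Prod>j\<le>m. h j (?Y (exp (- b * t) / c * x) \<omega> j)))" .
    ultimately show ?thesis by (simp only: extends_entire_mult)
  qed
  then show ?thesis by (rule extends_entire_imp_sums)
qed

end
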